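(* Let $\mathbb{F}\in\{\mathbb{R},\mathbb{C}\}$, let $n\ge 2$, let $\{f_i\}_{i=1}^k$ be a unit-norm frame for $\mathbb{F}^n$, and let $\widetilde{G}=(\langle \tilde f_i,\tilde f_j\rangle)_{i,j=1}^k$ be the Gramian associated to the diagram vectors $\{\tilde f_i\}_{i=1}^k$. Suppose $\widetilde{G}$ is not invertible. Let $\{v_1,\ldots,v_l\}$ be any basis of the null space of $\widetilde{G}$ in $\mathbb{R}^k$, and for $i=1,\ldots,k$ let $r_i=(v_1(i),\ldots,v_l(i))^T\in\mathbb{R}^l$. Then there exist $c_i>0$, $i=1,\ldots,k$, such that $\{c_if_i\}_{i=1}^k$ is a tight frame for $\mathbb{F}^n$ if and only if $0\notin \mathrm{conv}\{r_1,\ldots,r_k\}$.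
   Context: $\mathbb{F}^n$ carries its standard inner product; $f(i)$ denotes the $i$-th coordinate of $f$. A finite sequence $\{f_i\}_{i=1}^k$ in $\mathbb{F}^n$ is a frame if there are constants $0<A\le B<\infty$ with $A\|f\|^2\le\sum_{i=1}^k|\langle f,f_i\rangle|^2\le B\|f\|^2$ for all $f\in\mathbb{F}^n$ (equivalently, it spans $\mathbb{F}^n$). It is a tight frame if one can take $A=B$. It is unit-norm if $\|f_i\|=1$ for all $i$. Diagram vectors ($n\ge2$): for $f\in\mathbb{R}^n$, $\tilde f\in\mathbb{R}^{n(n-1)}$ is $\frac{1}{\sqrt{n-1}}$ times the vector whose entries are $f(i)^2-f(j)^2$ (once for each pair $i<j$) and $\sqrt{2n}\,f(i)f(j)$ (once for each pair $i<j$). For $f\in\mathbb{C}^n$, $\tilde f\in\mathbb{C}^{3n(n-1)/2}$ is $\frac{1}{\sqrt{n-1}}$ times the vector whose entries are $f(i)\overline{f(i)}-f(j)\overline{f(j)}$ (once for each pair $i<j$) and $\sqrt{n}\,f(i)\overline{f(j)}$ (once for each ordered pair $i\ne j$). The ordering of the entries is fixed, the same for all $f$. For unit-norm vectors the matrix $\widetilde G$ has real entries in both cases. $\mathrm{conv}$ denotes the convex hull. *)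

theory Defs
  imports "HOL-Analysis.Analysis"
begin

text \<open>
  The dimension n is \<open>CARD('n)\<close>. The sort constraint \<open>{card2, linorder}\<close> says that
  \<open>n \<ge> 2\<close> (class \<open>card2\<close>) and that the coordinates are linearly ordered, so that pairs
  \<open>i < j\<close> make sense. On \<open>complex ^ 'n\<close> the library's \<open>(\<bullet>)\<close> is only the real part of the
  standard inner product, hence the separate definition \<open>hermitian\<close>; the frame notions take
  the inner product as an argument and are used with \<open>(\<bullet>)\<close> on \<open>real ^ 'n\<close> and with
  \<open>hermitian\<close> on \<open>complex ^ 'n\<close>.
\<close>

definition hermitian :: "complex ^ 'n \<Rightarrow> complex ^ 'n \<Rightarrow> complex" where
  "hermitian x y = (\<Sum>i\<in>UNIV. x $ i * cnj (y $ i))"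

definition frame_bounds ::
  "('v \<Rightarrow> 'v \<Rightarrow> 'a::real_normed_field) \<Rightarrow> ('k::finite \<Rightarrow> 'v::real_normed_vector) \<Rightarrow> real \<Rightarrow> real \<Rightarrow> bool"
  where
  "frame_bounds ip f A B \<longleftrightarrow> 0 < A \<and> A \<le> B \<and>
     (\<forall>x. A * (norm x)\<^sup>2 \<le> (\<Sum>i\<in>UNIV. (norm (ip x (f i)))\<^sup>2) \<and>
          (\<Sum>i\<in>UNIV. (norm (ip x (f i)))\<^sup>2) \<le> B * (norm x)\<^sup>2)"

definition is_frame ::
  "('v \<Rightarrow> 'v \<Rightarrow> 'a::real_normed_field) \<Rightarrow> ('k::finite \<Rightarrow> 'v::real_normed_vector) \<Rightarrow> bool" where
  "is_frame ip f \<longleftrightarrow> (\<exists>A B. frame_bounds ip f A B)"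

definition tight_frame ::
  "('v \<Rightarrow> 'v \<Rightarrow> 'a::real_normed_field) \<Rightarrow> ('k::finite \<Rightarrow> 'v::real_normed_vector) \<Rightarrow> bool" where
  "tight_frame ip f \<longleftrightarrow> (\<exists>A. frame_bounds ip f A A)"

definition unit_norm_frame ::
  "('v \<Rightarrow> 'v \<Rightarrow> 'a::real_normed_field) \<Rightarrow> ('k::finite \<Rightarrow> 'v::real_normed_vector) \<Rightarrow> bool" where
  "unit_norm_frame ip f \<longleftrightarrow> is_frame ip f \<and> (\<forall>i. norm (f i) = 1)"

definition gramian :: "('v \<Rightarrow> 'v \<Rightarrow> 'a) \<Rightarrow> ('k::finite \<Rightarrow> 'v) \<Rightarrow> 'a ^ 'k ^ 'k" where
  "gramian ip f = (\<chi> i j. ip (f i) (f j))"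

text \<open>
  The entries of a diagram vector are indexed by types of pairs rather than by numbers; the
  cardinalities are computed below. Both types are non-empty because \<open>n \<ge> 2\<close>.
\<close>

lemma card2_ex_less: "\<exists>i j :: 'n::{card2, linorder}. i < j"
proof (rule ccontr)
  assume "\<not> ?thesis"
  then have eq: "i = j" for i j :: 'n
    using neq_iff[of i j] by blast
  have "(UNIV :: 'n set) = {undefined}"
    using eq by auto
  then have "CARD('n) = card {undefined :: 'n}"
    by (rule arg_cong)
  then show False
    using two_le_card[where 'a = 'n] by simp
qed

typedef (overloaded) ('n::"{card2, linorder}") less_pair = "{(i :: 'n, j). i < j}"
  using card2_ex_less by auto

typedef (overloaded) ('n::"{card2, linorder}") neq_pair = "{(i :: 'n, j). i \<noteq> j}"
  using card2_ex_less by (auto dest: less_imp_neq)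

instance less_pair :: ("{card2, linorder}") finite
proof
  have "inj (Rep_less_pair :: 'a less_pair \<Rightarrow> _)"
    by (meson Rep_less_pair_inject injI)
  then show "finite (UNIV :: 'a less_pair set)"
    by (rule finite_imageD[rotated]) simp
qed

instance neq_pair :: ("{card2, linorder}") finite
proof
  have "inj (Rep_neq_pair :: 'a neq_pair \<Rightarrow> _)"
    by (meson Rep_neq_pair_inject injI)
  then show "finite (UNIV :: 'a neq_pair set)"
    by (rule finite_imageD[rotated]) simp
qed

definition real_diagram ::
  "real ^ 'n::{card2, linorder} \<Rightarrow> real ^ ('n less_pair + 'n less_pair)" where
  "real_diagram f = (1 / sqrt (real CARD('n) - 1)) *\<^sub>R
     (\<chi> p. case p of
        Inl q \<Rightarrow> (case Rep_less_pair q of (i, j) \<Rightarrow> (f $ i)\<^sup>2 - (f $ j)\<^sup>2)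
      | Inr q \<Rightarrow> (case Rep_less_pair q of (i, j) \<Rightarrow> sqrt (2 * real CARD('n)) * (f $ i) * (f $ j)))"

definition complex_diagram ::
  "complex ^ 'n::{card2, linorder} \<Rightarrow> complex ^ ('n less_pair + 'n neq_pair)" where
  "complex_diagram f = (1 / sqrt (real CARD('n) - 1)) *\<^sub>R
     (\<chi> p. case p of
        Inl q \<Rightarrow> (case Rep_less_pair q of (i, j) \<Rightarrow> (f $ i) * cnj (f $ i) - (f $ j) * cnj (f $ j))
      | Inr q \<Rightarrow> (case Rep_neq_pair q of (i, j) \<Rightarrow>
                    complex_of_real (sqrt (real CARD('n))) * (f $ i) * cnj (f $ j)))"

lemma CARD_less_pair: "2 * CARD('n::{card2, linorder} less_pair) = CARD('n) * (CARD('n) - 1)"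
proof -
  have bij: "bij_betw Rep_less_pair (UNIV :: 'n less_pair set) {(i, j). i < j}"
    unfolding bij_betw_def inj_on_def
    using Rep_less_pair_inject type_definition.Rep_range[OF type_definition_less_pair] by blast
  have swap: "bij_betw (\<lambda>(i, j). (j, i)) {(i :: 'n, j). i < j} {(i, j). j < i}"
    by (auto simp: bij_betw_def inj_on_def)
  have "{(i :: 'n, j). i \<noteq> j} = {(i, j). i < j} \<union> {(i, j). j < i}"
    by auto
  then have "card {(i :: 'n, j). i \<noteq> j} = card {(i :: 'n, j). i < j} + card {(i :: 'n, j). j < i}"
    by (subst card_Un_disjoint[symmetric]) (auto intro: finite_subset[OF subset_UNIV])
  moreover have "{(i :: 'n, j). i \<noteq> j} = (SIGMA i:UNIV. UNIV - {i})"
    by auto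
  ultimately show ?thesis
    using bij_betw_same_card[OF bij] bij_betw_same_card[OF swap] by simp
qed

lemma CARD_neq_pair: "CARD('n::{card2, linorder} neq_pair) = CARD('n) * (CARD('n) - 1)"
proof -
  have "bij_betw Rep_neq_pair (UNIV :: 'n neq_pair set) {(i, j). i \<noteq> j}"
    unfolding bij_betw_def inj_on_def
    using Rep_neq_pair_inject type_definition.Rep_range[OF type_definition_neq_pair] by blast
  moreover have "{(i :: 'n, j). i \<noteq> j} = (SIGMA i:UNIV. UNIV - {i})"
    by auto
  ultimately show ?thesis
    using bij_betw_same_card by fastforce
qed

text \<open>
  The complex Gramian has type \<open>complex ^ 'k ^ 'k\<close> although its entries are real for unit-norm
  vectors; its null space is nevertheless taken in \<open>\<real>\<^sup>k\<close>.
\<close>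

definition real_null_space :: "'a::real_algebra_1 ^ 'k ^ 'm \<Rightarrow> (real ^ 'k::finite) set" where
  "real_null_space A = {x. A *v (\<chi> j. of_real (x $ j)) = 0}"

definition basis_of :: "('l::finite \<Rightarrow> 'v::real_vector) \<Rightarrow> 'v set \<Rightarrow> bool" where
  "basis_of v S \<longleftrightarrow> inj v \<and> independent (range v) \<and> span (range v) = S"

end

theory Submission
  imports Defs
begin

text \<open>
  A real vector \<open>x\<close> lies in the null space of the Gramian iff \<open>\<Sum>j. x\<^sub>j g\<^sub>j = 0\<close>, where \<open>g\<^sub>j\<close> is the
  diagram vector of \<open>f\<^sub>j\<close>. The entries of this sum vanish exactly when \<open>\<Sum>j. x\<^sub>j f\<^sub>j f\<^sub>j\<^sup>*\<close> is a scalar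
  matrix, i.e. when \<open>\<Sum>j. x\<^sub>j |\<langle>y, f\<^sub>j\<rangle>|\<^sup>2\<close> is a multiple of \<open>\<parallel>y\<parallel>\<^sup>2\<close>. With \<open>x\<^sub>j = c\<^sub>j\<^sup>2\<close>, tight scalings
  are the strictly positive vectors of the null space. Those are the vectors \<open>(r\<^sub>i \<bullet> z)\<^sub>i\<close> with
  all \<open>r\<^sub>i \<bullet> z > 0\<close>, so they exist iff a hyperplane strictly separates \<open>0\<close> from \<open>conv {r\<^sub>i}\<close>.
\<close>

section \<open>Convexity: strictly positive vectors in a span\<close>

lemma span_range_eq:
  fixes v :: "'l::finite \<Rightarrow> 'v::real_vector"
  shows "span (range v) = range (\<lambda>y :: real ^ 'l. \<Sum>a\<in>UNIV. (y $ a) *\<^sub>R v a)"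
    (is "_ = range ?L")
proof
  have "linear ?L"
    by (intro linearI) (simp_all add: scaleR_left_distrib sum.distrib scaleR_sum_right)
  then have "subspace (range ?L)"
    using linear_subspace_image subspace_UNIV by blast
  moreover have "v b = ?L (axis b 1)" for b
    by (simp add: axis_def if_distrib[where f = "\<lambda>t. t *\<^sub>R _"] cong: if_cong)
  then have "range v \<subseteq> range ?L" by blast
  ultimately show "span (range v) \<subseteq> range ?L"
    by (rule span_minimal[rotated])
  show "range ?L \<subseteq> span (range v)"
    by (auto intro!: span_sum span_scale intro: span_base)
qed

text \<open>The hull of a finite set is compact, hence closed, so a hyperplane strictly separates it
  from 0; its normal is \<open>y\<close>. Conversely an open half-space is convex, so it contains
  the hull as soon as it contains \<open>S\<close>.\<close>

lemma zero_notin_convex_hull_iff: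
  fixes S :: "'a::euclidean_space set"
  assumes "finite S" "S \<noteq> {}"
  shows "0 \<notin> convex hull S \<longleftrightarrow> (\<exists>y. \<forall>s\<in>S. s \<bullet> y > 0)"
proof
  assume "0 \<notin> convex hull S"
  moreover have "closed (convex hull S)"
    using assms by (simp add: finite_imp_compact_convex_hull compact_imp_closed)
  ultimately obtain y b where "b > 0" "\<And>x. x \<in> convex hull S \<Longrightarrow> y \<bullet> x > b"
    using separating_hyperplane_closed_0[of "convex hull S"] by auto
  then show "\<exists>y. \<forall>s\<in>S. s \<bullet> y > 0"
    by (metis hull_inc inner_commute less_trans)
next
  assume "\<exists>y. \<forall>s\<in>S. s \<bullet> y > 0"
  then obtain y where "S \<subseteq> {x. y \<bullet> x > 0}"
    by (auto simp: inner_commute)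
  then have "convex hull S \<subseteq> {x. y \<bullet> x > 0}"
    by (simp add: hull_minimal convex_halfspace_gt)
  then show "0 \<notin> convex hull S"
    by auto
qed

text \<open>The i-th coordinate of a combination of the \<open>v a\<close> with coefficients
  \<open>y\<close> is the inner product of \<open>y\<close> with the i-th row vector. Thus
  coefficients of a positive vector are the same thing as the normal of a separating
  hyperplane.\<close>

lemma positive_in_span_iff:
  fixes v :: "'l::finite \<Rightarrow> real ^ 'k::finite"
  shows "(\<exists>x\<in>span (range v). \<forall>i. x $ i > 0) \<longleftrightarrow>
    0 \<notin> convex hull (range (\<lambda>i. \<chi> a. v a $ i))"
  by (simp add: span_range_eq zero_notin_convex_hull_iff inner_vec_def mult.commute)

section \<open>Gramians and tight scalings for a general inner product\<close>

lemma real_null_space_gramian: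
  fixes ip :: "'v::real_normed_vector \<Rightarrow> 'v \<Rightarrow> 'a::real_normed_field"
  assumes "bilinear ip" and definite: "\<And>x. ip x x = 0 \<Longrightarrow> x = 0"
  shows "x \<in> real_null_space (gramian ip d) \<longleftrightarrow> (\<Sum>j\<in>UNIV. (x $ j) *\<^sub>R d j) = 0"
proof -
  define s where "s = (\<Sum>j\<in>UNIV. (x $ j) *\<^sub>R d j)"
  \<comment> \<open>Only real linearity is needed, because the coefficients \<open>x\<close> are
    real. This admits \<open>hermitian\<close>, which is conjugate-linear in its second
    argument.\<close>
  have lin: "linear (ip y)" "linear (\<lambda>y. ip y z)" for y z
    using assms(1) by (auto simp: bilinear_def)
  have "(gramian ip d *v (\<chi> j. of_real (x $ j))) $ i = ip (d i) s" for i
    by (simp add: gramian_def matrix_vector_mult_def s_def linear_sum[OF lin(1)]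
        linear_cmul[OF lin(1)] scaleR_conv_of_real mult.commute)
  then have "x \<in> real_null_space (gramian ip d) \<longleftrightarrow> (\<forall>i. ip (d i) s = 0)"
    by (simp add: real_null_space_def vec_eq_iff)
  also have "\<dots> \<longleftrightarrow> s = 0"
  proof
    assume "\<forall>i. ip (d i) s = 0"
    \<comment> \<open>Combining the vanishing products with the coefficients of \<open>s\<close>
      itself yields \<open>ip s s\<close>.\<close>
    then have "(\<Sum>j\<in>UNIV. (x $ j) *\<^sub>R ip (d j) s) = 0" by simp
    then have "ip s s = 0"
      by (subst s_def, subst linear_sum[OF lin(2)]) (simp add: linear_cmul[OF lin(2)])
    then show "s = 0" by (rule definite)
  qed (simp add: linear_0[OF lin(1)])
  finally show ?thesis by (simp add: s_def)
qed

lemma tight_scaling_iff: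
  fixes ip :: "'v::real_normed_vector \<Rightarrow> 'v \<Rightarrow> 'a::real_normed_field"
    and f :: "'k::finite \<Rightarrow> 'v"
  assumes scale: "\<And>x y r. norm (ip x (r *\<^sub>R y)) = \<bar>r\<bar> * norm (ip x y)"
    and norm_ip: "\<And>x. norm (ip x x) = (norm x)\<^sup>2"
    and unit: "\<And>i. norm (f i) = 1"
  shows "(\<exists>c :: 'k \<Rightarrow> real. (\<forall>i. c i > 0) \<and> tight_frame ip (\<lambda>i. c i *\<^sub>R f i)) \<longleftrightarrow>
    (\<exists>x :: real ^ 'k. (\<exists>A. \<forall>y. (\<Sum>j\<in>UNIV. x $ j * (norm (ip y (f j)))\<^sup>2) = A * (norm y)\<^sup>2) \<and>
      (\<forall>i. x $ i > 0))"
    (is "?L \<longleftrightarrow> ?R")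
proof
  assume ?L
  then obtain c A where c: "\<And>i. c i > 0" and "frame_bounds ip (\<lambda>i. c i *\<^sub>R f i) A A"
    by (auto simp: tight_frame_def)
  then have "(\<Sum>j\<in>UNIV. (c j)\<^sup>2 * (norm (ip y (f j)))\<^sup>2) = A * (norm y)\<^sup>2" for y
    by (force simp: frame_bounds_def scale power_mult_distrib intro: antisym)
  then show ?R
    using c by (intro exI[of _ "\<chi> j. (c j)\<^sup>2"]) (auto simp: less_imp_neq[symmetric])
next
  assume ?R
  then obtain x :: "real ^ 'k" and A
    where eq: "\<And>y. (\<Sum>j\<in>UNIV. x $ j * (norm (ip y (f j)))\<^sup>2) = A * (norm y)\<^sup>2"
      and pos: "\<And>i. x $ i > 0"
    by auto
  \<comment> \<open>A frame bound must be positive, which the identity \<open>eq\<close> does not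
    state. At the unit vector \<open>f i\<close> its right side is \<open>A\<close>, while the
    summand with j = i on the left is \<open>x $ i\<close> and no summand is negative.\<close>
  have "0 < (\<Sum>j\<in>UNIV. x $ j * (norm (ip (f i) (f j)))\<^sup>2)" for i
    by (rule sum_pos2[of _ i]) (use pos in \<open>auto simp: norm_ip unit less_imp_le\<close>)
  then have "A > 0"
    unfolding eq by (simp add: unit)
  then have "frame_bounds ip (\<lambda>i. sqrt (x $ i) *\<^sub>R f i) A A"
    using pos by (simp add: frame_bounds_def scale power_mult_distrib less_imp_le eq)
  then show ?L
    using pos by (intro exI[of _ "\<lambda>i. sqrt (x $ i)"]) (auto simp: tight_frame_def)
qed

section \<open>Diagram vectors and scalar matrices\<close>

lemma all_less_pair:
  "(\<forall>q :: 'n::{card2, linorder} less_pair. P (Rep_less_pair q)) \<longleftrightarrow> (\<forall>i j. i < j \<longrightarrow> P (i, j))"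
proof -
  have "(\<forall>q. P (Rep_less_pair q)) \<longleftrightarrow> (\<forall>p\<in>range (Rep_less_pair :: 'n less_pair \<Rightarrow> _). P p)"
    by blast
  then show ?thesis
    by (auto simp: type_definition.Rep_range[OF type_definition_less_pair])
qed

lemma all_neq_pair:
  "(\<forall>q :: 'n::{card2, linorder} neq_pair. P (Rep_neq_pair q)) \<longleftrightarrow> (\<forall>i j. i \<noteq> j \<longrightarrow> P (i, j))"
proof -
  have "(\<forall>q. P (Rep_neq_pair q)) \<longleftrightarrow> (\<forall>p\<in>range (Rep_neq_pair :: 'n neq_pair \<Rightarrow> _). P p)"
    by blast
  then show ?thesis
    by (auto simp: type_definition.Rep_range[OF type_definition_neq_pair])
qed

lemma sqrt_CARD_minus_one_neq_0: "sqrt (real CARD('n::card2) - 1) \<noteq> 0"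
  using two_le_card[where 'a = 'n] by simp

text \<open>Breaks scalarity of a matrix into the conditions that the two kinds of diagram entries
  express. Linearity of the order extends the comparisons for a < b to all diagonal entries, so any
  one of them can serve as \<open>A\<close>.\<close>

lemma scalar_matrix_iff:
  fixes M :: "'n::linorder \<Rightarrow> 'n \<Rightarrow> 'a::zero"
  shows "(\<exists>A. \<forall>a b. M a b = (if a = b then A else 0)) \<longleftrightarrow>
    (\<forall>a b. a < b \<longrightarrow> M a a = M b b) \<and> (\<forall>a b. a \<noteq> b \<longrightarrow> M a b = 0)"
proof
  assume R: "(\<forall>a b. a < b \<longrightarrow> M a a = M b b) \<and> (\<forall>a b. a \<noteq> b \<longrightarrow> M a b = 0)"
  then have "M a a = M b b" for a b
    by (metis linorder_less_linear)
  with R show "\<exists>A. \<forall>a b. M a b = (if a = b then A else 0)"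
    by (intro exI[of _ "M undefined undefined"]) auto
qed auto

text \<open>Diagram entries are linear in the rank-one matrix of products of coordinates, so the sum
  has the same shape with \<open>M\<close> in place of that matrix, and the nonzero normalising
  factors do not affect its vanishing. The entries see \<open>M\<close> only above the diagonal;
  symmetry of \<open>M\<close> supplies the rest.\<close>

lemma real_diagram_sum_eq_0_iff:
  fixes f :: "'k::finite \<Rightarrow> real ^ 'n::{card2, linorder}" and x :: "real ^ 'k"
  shows "(\<Sum>j\<in>UNIV. (x $ j) *\<^sub>R real_diagram (f j)) = 0 \<longleftrightarrow>
    (\<exists>A. \<forall>a b. (\<Sum>j\<in>UNIV. x $ j * (f j $ a * f j $ b)) = (if a = b then A else 0))"
proof -
  define M where "M a b = (\<Sum>j\<in>UNIV. x $ j * (f j $ a * f j $ b))" for a b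
  have sym: "M a b = M b a" for a b
    by (simp add: M_def mult.commute)
  have off_diagonal: "(\<forall>a b. a < b \<longrightarrow> M a b = 0) \<longleftrightarrow> (\<forall>a b. a \<noteq> b \<longrightarrow> M a b = 0)"
    by (metis neq_iff sym)
  have "(\<Sum>j\<in>UNIV. (x $ j) *\<^sub>R real_diagram (f j)) =
    (1 / sqrt (real CARD('n) - 1)) *\<^sub>R
     (\<chi> p. case p of
        Inl q \<Rightarrow> (case Rep_less_pair q of (i, j) \<Rightarrow> M i i - M j j)
      | Inr q \<Rightarrow> (case Rep_less_pair q of (i, j) \<Rightarrow> sqrt (2 * real CARD('n)) * M i j))"
    by (simp add: vec_eq_iff real_diagram_def M_def sum_distrib_left sum_subtractf[symmetric]
        power2_eq_square algebra_simps sum_divide_distrib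
        split: sum.split prod.split)
  then have "(\<Sum>j\<in>UNIV. (x $ j) *\<^sub>R real_diagram (f j)) = 0 \<longleftrightarrow>
    (\<forall>q :: 'n less_pair. case Rep_less_pair q of (i, j) \<Rightarrow> M i i = M j j) \<and>
    (\<forall>q :: 'n less_pair. case Rep_less_pair q of (i, j) \<Rightarrow> M i j = 0)"
    using sqrt_CARD_minus_one_neq_0[where 'n = 'n]
    by (simp add: vec_eq_iff split_sum_all case_prod_beta)
  also have "\<dots> \<longleftrightarrow> (\<forall>a b. a < b \<longrightarrow> M a a = M b b) \<and> (\<forall>a b. a \<noteq> b \<longrightarrow> M a b = 0)"
    by (subst (1 2) all_less_pair) (simp add: off_diagonal)
  finally show ?thesis
    unfolding scalar_matrix_iff by (simp add: M_def)
qed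

text \<open>As in the real case, except that the diagram lists both orders of each pair, so all
  off-diagonal entries of \<open>M\<close> appear directly.\<close>

lemma complex_diagram_sum_eq_0_iff:
  fixes f :: "'k::finite \<Rightarrow> complex ^ 'n::{card2, linorder}" and x :: "real ^ 'k"
  shows "(\<Sum>j\<in>UNIV. (x $ j) *\<^sub>R complex_diagram (f j)) = 0 \<longleftrightarrow>
    (\<exists>A. \<forall>a b. (\<Sum>j\<in>UNIV. of_real (x $ j) * (f j $ a * cnj (f j $ b))) = (if a = b then A else 0))"
proof -
  define M where "M a b = (\<Sum>j\<in>UNIV. of_real (x $ j) * (f j $ a * cnj (f j $ b)))" for a b
  have "(\<Sum>j\<in>UNIV. (x $ j) *\<^sub>R complex_diagram (f j)) =
    (1 / sqrt (real CARD('n) - 1)) *\<^sub>R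
     (\<chi> p. case p of
        Inl q \<Rightarrow> (case Rep_less_pair q of (i, j) \<Rightarrow> M i i - M j j)
      | Inr q \<Rightarrow> (case Rep_neq_pair q of (i, j) \<Rightarrow>
          complex_of_real (sqrt (real CARD('n))) * M i j))"
    by (simp add: vec_eq_iff complex_diagram_def M_def sum_distrib_left sum_subtractf[symmetric]
        scaleR_conv_of_real[where 'a = complex] algebra_simps sum_divide_distrib
        split: sum.split prod.split)
  then have "(\<Sum>j\<in>UNIV. (x $ j) *\<^sub>R complex_diagram (f j)) = 0 \<longleftrightarrow>
    (\<forall>q :: 'n less_pair. case Rep_less_pair q of (i, j) \<Rightarrow> M i i = M j j) \<and>
    (\<forall>q :: 'n neq_pair. case Rep_neq_pair q of (i, j) \<Rightarrow> M i j = 0)"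
    using sqrt_CARD_minus_one_neq_0[where 'n = 'n]
    by (simp add: vec_eq_iff split_sum_all case_prod_beta)
  also have "\<dots> \<longleftrightarrow> (\<forall>a b. a < b \<longrightarrow> M a a = M b b) \<and> (\<forall>a b. a \<noteq> b \<longrightarrow> M a b = 0)"
    by (subst all_less_pair, subst all_neq_pair) auto
  finally show ?thesis
    unfolding scalar_matrix_iff by (simp add: M_def)
qed

section \<open>Scalar matrices and quadratic forms\<close>

lemma real_scalar_form_iff:
  fixes f :: "'k::finite \<Rightarrow> real ^ 'n" and w :: "'k \<Rightarrow> real"
  shows "(\<forall>a b. (\<Sum>j\<in>UNIV. w j * (f j $ a * f j $ b)) = (if a = b then A else 0)) \<longleftrightarrow>
    (\<forall>y. (\<Sum>j\<in>UNIV. w j * (norm (y \<bullet> f j))\<^sup>2) = A * (norm y)\<^sup>2)"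
    (is "?L \<longleftrightarrow> ?R")
proof
  define M where "M a b = (\<Sum>j\<in>UNIV. w j * (f j $ a * f j $ b))" for a b
  \<comment> \<open>The weighted sum of squares is the quadratic form of \<open>M\<close>, after
    expanding each square and exchanging sums.\<close>
  have form: "(\<Sum>j\<in>UNIV. w j * (norm (y \<bullet> f j))\<^sup>2) = (\<Sum>a\<in>UNIV. \<Sum>b\<in>UNIV. y $ a * y $ b * M a b)"
    for y
  proof -
    have "(\<Sum>j\<in>UNIV. w j * (norm (y \<bullet> f j))\<^sup>2) =
      (\<Sum>j\<in>UNIV. \<Sum>a\<in>UNIV. \<Sum>b\<in>UNIV. y $ a * y $ b * (w j * (f j $ a * f j $ b)))"
      by (simp add: inner_vec_def power2_eq_square sum_product sum_distrib_left mult_ac)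
    also have "\<dots> = (\<Sum>a\<in>UNIV. \<Sum>b\<in>UNIV. \<Sum>j\<in>UNIV. y $ a * y $ b * (w j * (f j $ a * f j $ b)))"
      by (subst sum.swap, intro sum.cong refl, rule sum.swap)
    finally show ?thesis by (simp add: M_def sum_distrib_left)
  qed
  show ?R if ?L
  proof
    fix y :: "real ^ 'n"
    have "(\<Sum>j\<in>UNIV. w j * (norm (y \<bullet> f j))\<^sup>2) = A * (y \<bullet> y)"
      using that unfolding form M_def[symmetric]
      by (simp add: inner_vec_def sum_distrib_left mult_ac
          if_distrib[where f = "\<lambda>t. _ * t"] cong: if_cong)
    then show "(\<Sum>j\<in>UNIV. w j * (norm (y \<bullet> f j))\<^sup>2) = A * (norm y)\<^sup>2"
      by (simp only: power2_norm_eq_inner)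
  qed
  show ?L if ?R
  proof -
    have diag: "M a a = A" for a
      using that[rule_format, of "axis a 1"]
      by (simp add: M_def inner_axis' power2_eq_square)
    have "M a b = 0" if "a \<noteq> b" for a b
    proof -
      \<comment> \<open>Polarization: the form takes the value 2A at the sum of two distinct axis
        vectors, and the diagonal entries already account for 2A.\<close>
      have "(\<Sum>j\<in>UNIV. w j * (norm ((axis a 1 + axis b 1) \<bullet> f j))\<^sup>2) = M a a + M b b + 2 * M a b"
        by (simp add: M_def inner_axis' inner_add_left power2_eq_square algebra_simps
            sum.distrib sum_distrib_left)
      moreover have "(norm (axis a 1 + axis b 1 :: real ^ 'n))\<^sup>2 = 2"
        using that by (simp add: power2_norm_eq_inner inner_add_left inner_add_right
            inner_axis_axis)
      ultimately show ?thesis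
        using \<open>?R\<close> diag[of a] diag[of b] by simp
    qed
    with diag show ?thesis by (simp add: M_def)
  qed
qed

lemma hermitian_simps:
  "hermitian (x + y) z = hermitian x z + hermitian y z"
  "hermitian x (y + z) = hermitian x y + hermitian x z"
  "hermitian (r *\<^sub>R x) y = r *\<^sub>R hermitian x y"
  "hermitian x (r *\<^sub>R y) = r *\<^sub>R hermitian x y"
  by (simp_all add: hermitian_def algebra_simps sum.distrib scaleR_sum_right)

lemma hermitian_axis: "hermitian (axis a t) y = t * cnj (y $ a)"
  by (simp add: hermitian_def axis_def if_distrib[where f = "\<lambda>t. t * _"] cong: if_cong)

lemma bilinear_hermitian: "bilinear hermitian"
  by (simp add: bilinear_def linear_iff hermitian_simps)

lemma hermitian_self: "hermitian x x = of_real ((norm x)\<^sup>2)"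
  by (simp add: hermitian_def norm_vec_def L2_set_def sum_nonneg complex_norm_square
      flip: of_real_power)

lemma complex_scalar_form_iff:
  fixes f :: "'k::finite \<Rightarrow> complex ^ 'n" and w :: "'k \<Rightarrow> real"
  shows "(\<forall>a b. (\<Sum>j\<in>UNIV. of_real (w j) * (f j $ a * cnj (f j $ b))) =
      (if a = b then of_real A else 0)) \<longleftrightarrow>
    (\<forall>y. (\<Sum>j\<in>UNIV. w j * (norm (hermitian y (f j)))\<^sup>2) = A * (norm y)\<^sup>2)"
    (is "?L \<longleftrightarrow> ?R")
proof
  define M where "M a b = (\<Sum>j\<in>UNIV. of_real (w j) * (f j $ a * cnj (f j $ b)))" for a b
  have form: "of_real (\<Sum>j\<in>UNIV. w j * (norm (hermitian y (f j)))\<^sup>2) =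
      (\<Sum>a\<in>UNIV. \<Sum>b\<in>UNIV. cnj (y $ a) * y $ b * M a b)" for y
  proof -
    have "of_real (\<Sum>j\<in>UNIV. w j * (norm (hermitian y (f j)))\<^sup>2) =
      (\<Sum>j\<in>UNIV. of_real (w j) * (cnj (hermitian y (f j)) * hermitian y (f j)))"
      by (simp add: complex_norm_square mult_ac flip: of_real_power)
    also have "\<dots> = (\<Sum>j\<in>UNIV. \<Sum>a\<in>UNIV. \<Sum>b\<in>UNIV.
        cnj (y $ a) * y $ b * (of_real (w j) * (f j $ a * cnj (f j $ b))))"
      by (simp add: hermitian_def sum_product sum_distrib_left mult_ac)
    also have "\<dots> = (\<Sum>a\<in>UNIV. \<Sum>b\<in>UNIV. \<Sum>j\<in>UNIV.
        cnj (y $ a) * y $ b * (of_real (w j) * (f j $ a * cnj (f j $ b))))"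
      by (subst sum.swap, intro sum.cong refl, rule sum.swap)
    finally show ?thesis by (simp add: M_def sum_distrib_left)
  qed
  show ?R if ?L
  proof
    fix y
    have "of_real (\<Sum>j\<in>UNIV. w j * (norm (hermitian y (f j)))\<^sup>2) = of_real A * hermitian y y"
      using that unfolding form M_def[symmetric]
      by (simp add: hermitian_def sum_distrib_left mult_ac
          if_distrib[where f = "\<lambda>t. _ * t"] cong: if_cong)
    then show "(\<Sum>j\<in>UNIV. w j * (norm (hermitian y (f j)))\<^sup>2) = A * (norm y)\<^sup>2"
      unfolding hermitian_self by (metis of_real_eq_iff of_real_mult)
  qed
  show ?L if R: ?R
  proof -
    \<comment> \<open>The hypothesis is moved into the complex numbers, where the squared modulus
      becomes a product with the conjugate and can be expanded.\<close>
    have quad: "(\<Sum>j\<in>UNIV. of_real (w j) * (hermitian y (f j) * cnj (hermitian y (f j)))) =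
        of_real A * hermitian y y" for y
      unfolding hermitian_self complex_norm_square[symmetric]
      using arg_cong[OF R[rule_format, of y], of complex_of_real] by simp
    have axis_nth_if: "(axis b s :: complex ^ 'n) $ a = (if a = b then s else 0)" for a b s
      by (simp add: axis_def)
    have diag: "M a a = of_real A" for a
      using quad[of "axis a 1"]
      by (simp add: M_def hermitian_axis mult_ac)
    \<comment> \<open>Polarization with coefficients \<open>t\<close>, \<open>s\<close> of modulus
      1: the diagonal part cancels against A times the squared norm, leaving the two cross
      terms.\<close>
    have off: "t * cnj s * M b a + s * cnj t * M a b = 0"
      if "a \<noteq> b" "t * cnj t = 1" "s * cnj s = 1" for a b s t
    proof -
      let ?y = "axis a t + axis b s :: complex ^ 'n"
      have "(\<Sum>j\<in>UNIV. of_real (w j) * (hermitian ?y (f j) * cnj (hermitian ?y (f j)))) =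
          t * cnj t * M a a + s * cnj s * M b b + t * cnj s * M b a + s * cnj t * M a b"
        by (simp add: M_def hermitian_simps hermitian_axis algebra_simps sum.distrib sum_distrib_left)
      moreover have "hermitian ?y ?y = t * cnj t + s * cnj s"
        using that(1) by (simp add: hermitian_simps hermitian_axis axis_nth_if)
      ultimately show ?thesis
        using quad[of ?y] that by (simp add: diag)
    qed
    \<comment> \<open>The coefficients (1, 1) give M b a + M a b = 0. Replacing the second by the
      imaginary unit gives M a b = M b a, so both entries vanish.\<close>
    have "M a b = 0" if "a \<noteq> b" for a b
      using off[of a b 1 1] off[of a b 1 \<i>] that by (simp add: add_eq_0_iff)
    with diag show ?thesis by (simp add: M_def)
  qed
qed

section \<open>Null spaces of the diagram Gramians and the characterization of scalability\<close>

lemma real_null_space_real_diagram_iff: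
  fixes f :: "'k::finite \<Rightarrow> real ^ 'n::{card2, linorder}"
  shows "x \<in> real_null_space (gramian (\<bullet>) (\<lambda>i. real_diagram (f i))) \<longleftrightarrow>
    (\<exists>A. \<forall>y. (\<Sum>j\<in>UNIV. x $ j * (norm (y \<bullet> f j))\<^sup>2) = A * (norm y)\<^sup>2)"
  by (subst real_null_space_gramian)
    (auto simp: bilinear_conv_bounded_bilinear bounded_bilinear_inner
      real_diagram_sum_eq_0_iff real_scalar_form_iff[where w = "($) x"])

lemma real_null_space_complex_diagram_iff:
  fixes f :: "'k::finite \<Rightarrow> complex ^ 'n::{card2, linorder}"
  shows "x \<in> real_null_space (gramian hermitian (\<lambda>i. complex_diagram (f i))) \<longleftrightarrow>
    (\<exists>A. \<forall>y. (\<Sum>j\<in>UNIV. x $ j * (norm (hermitian y (f j)))\<^sup>2) = A * (norm y)\<^sup>2)"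
proof -
  have "x \<in> real_null_space (gramian hermitian (\<lambda>i. complex_diagram (f i))) \<longleftrightarrow>
    (\<exists>A. \<forall>a b. (\<Sum>j\<in>UNIV. of_real (x $ j) * (f j $ a * cnj (f j $ b))) = (if a = b then A else 0))"
    (is "_ \<longleftrightarrow> (\<exists>A. ?scalar A)")
    by (subst real_null_space_gramian)
      (auto simp: bilinear_hermitian hermitian_self complex_diagram_sum_eq_0_iff)
  \<comment> \<open>The scalar is a priori complex. It equals a diagonal entry, which is a real
    combination of squared moduli, and hence is real.\<close>
  also have "\<dots> \<longleftrightarrow> (\<exists>A. ?scalar (complex_of_real A))"
  proof
    assume "\<exists>A. ?scalar A"
    then obtain A where A: "?scalar A" ..
    then have "A = (\<Sum>j\<in>UNIV. of_real (x $ j) * (f j $ undefined * cnj (f j $ undefined)))"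
      by simp
    also have "\<dots> = of_real (\<Sum>j\<in>UNIV. x $ j * (norm (f j $ undefined))\<^sup>2)"
      by (simp add: complex_norm_square flip: of_real_power)
    finally show "\<exists>A. ?scalar (complex_of_real A)" using A by blast
  qed blast
  finally show ?thesis
    unfolding complex_scalar_form_iff[where w = "($) x"] .
qed

theorem theorem3p2:
  fixes v :: "'l::finite \<Rightarrow> real ^ 'k::finite"
  shows
    "(\<forall>f :: 'k \<Rightarrow> real ^ 'n::{card2, linorder}.
        unit_norm_frame (\<bullet>) f \<longrightarrow>
        \<not> invertible (gramian (\<bullet>) (\<lambda>i. real_diagram (f i))) \<longrightarrow>
        basis_of v (real_null_space (gramian (\<bullet>) (\<lambda>i. real_diagram (f i)))) \<longrightarrow>
        ((\<exists>c :: 'k \<Rightarrow> real. (\<forall>i. c i > 0) \<and> tight_frame (\<bullet>) (\<lambda>i. c i *\<^sub>R f i))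
          \<longleftrightarrow> 0 \<notin> convex hull (range (\<lambda>i. \<chi> a. v a $ i))))
     \<and>
     (\<forall>f :: 'k \<Rightarrow> complex ^ 'n::{card2, linorder}.
        unit_norm_frame hermitian f \<longrightarrow>
        \<not> invertible (gramian hermitian (\<lambda>i. complex_diagram (f i))) \<longrightarrow>
        basis_of v (real_null_space (gramian hermitian (\<lambda>i. complex_diagram (f i)))) \<longrightarrow>
        ((\<exists>c :: 'k \<Rightarrow> real. (\<forall>i. c i > 0) \<and> tight_frame hermitian (\<lambda>i. c i *\<^sub>R f i))
          \<longleftrightarrow> 0 \<notin> convex hull (range (\<lambda>i. \<chi> a. v a $ i))))"
proof (intro conjI allI impI)
  fix f :: "'k \<Rightarrow> real ^ 'n::{card2, linorder}"
  assume "unit_norm_frame (\<bullet>) f"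
    and "basis_of v (real_null_space (gramian (\<bullet>) (\<lambda>i. real_diagram (f i))))"
  then have unit: "norm (f i) = 1"
    and span: "span (range v) = real_null_space (gramian (\<bullet>) (\<lambda>i. real_diagram (f i)))" for i
    by (auto simp: unit_norm_frame_def basis_of_def)
  show "(\<exists>c :: 'k \<Rightarrow> real. (\<forall>i. c i > 0) \<and> tight_frame (\<bullet>) (\<lambda>i. c i *\<^sub>R f i))
      \<longleftrightarrow> 0 \<notin> convex hull (range (\<lambda>i. \<chi> a. v a $ i))"
    \<comment> \<open>The hull condition turns into a positive vector of the span, that is, of the
      null space, and then into a weight vector whose form is a multiple of the squared norm. This
      is the right side of \<open>tight_scaling_iff\<close>.\<close>
    unfolding positive_in_span_iff[symmetric] span Bex_def real_null_space_real_diagram_iff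
    by (rule tight_scaling_iff) (simp_all add: abs_mult power2_norm_eq_inner unit)
next
  fix f :: "'k \<Rightarrow> complex ^ 'n::{card2, linorder}"
  assume "unit_norm_frame hermitian f"
    and "basis_of v (real_null_space (gramian hermitian (\<lambda>i. complex_diagram (f i))))"
  then have unit: "norm (f i) = 1"
    and span: "span (range v) = real_null_space (gramian hermitian (\<lambda>i. complex_diagram (f i)))"
    for i
    by (auto simp: unit_norm_frame_def basis_of_def)
  show "(\<exists>c :: 'k \<Rightarrow> real. (\<forall>i. c i > 0) \<and> tight_frame hermitian (\<lambda>i. c i *\<^sub>R f i))
      \<longleftrightarrow> 0 \<notin> convex hull (range (\<lambda>i. \<chi> a. v a $ i))"
    unfolding positive_in_span_iff[symmetric] span Bex_def real_null_space_complex_diagram_iff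
    by (rule tight_scaling_iff) (simp_all add: hermitian_simps hermitian_self norm_power unit)
qed

end
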